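(* Let $\mathcal{F}\in\mathbb{C}^{n_1\times n_2\times n_3\times n_4}$ with $n_1\le n_2\le n_3\le n_4$. Then for any permutation $\pi$ of $(1,2,3,4)$, $$\operatorname{rank}(\boldsymbol{M}(\mathcal{F}_\pi))\le \operatorname{rank}_{CP}(\mathcal{F}_\pi)\le n_1n_3\cdot\operatorname{rank}(\boldsymbol{M}(\mathcal{F}_\pi)).$$ Moreover, these inequalities can be sharpened to $$\operatorname{rank}_{M^+}(\mathcal{F})\le\operatorname{rank}_{CP}(\mathcal{F})\le n_1n_3\cdot\operatorname{rank}_{M^-}(\mathcal{F}).$$
   Context: $\otimes$ is the outer product. The CP-rank $\operatorname{rank}_{CP}(\mathcal{F})$ of $\mathcal{F}\in\mathbb{C}^{n_1\times\cdots\times n_d}$ is the smallest integer $r$ such that $\mathcal{F}=\sum_{i=1}^r a^{1,i}\otimes a^{2,i}\otimes\cdots\otimes a^{d,i}$ with $a^{k,i}\in\mathbb{C}^{n_k}$. The square unfolding of a fourth-order tensor $\mathcal{G}\in\mathbb{C}^{m_1\times m_2\times m_3\times m_4}$ is the matrix $\boldsymbol{M}(\mathcal{G})\in\mathbb{C}^{(m_1m_2)\times(m_3m_4)}$ whose rows are indexed by $(i_1,i_2)$, whose columns are indexed by $(i_3,i_4)$, with corresponding entry $\mathcal{G}_{i_1i_2i_3i_4}$. For a permutation $\pi$ with $\pi(1,2,3,4)=(j_1,j_2,j_3,j_4)$, $\mathcal{F}_\pi\in\mathbb{C}^{n_{j_1}\times n_{j_2}\times n_{j_3}\times n_{j_4}}$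 is the tensor obtained from $\mathcal{F}$ by permuting its indices according to $\pi$, i.e. $(\mathcal{F}_\pi)_{i_{j_1}i_{j_2}i_{j_3}i_{j_4}}=\mathcal{F}_{i_1i_2i_3i_4}$. $\operatorname{rank}_{M^-}(\mathcal{F})=\min_\pi\operatorname{rank}(\boldsymbol{M}(\mathcal{F}_\pi))$ and $\operatorname{rank}_{M^+}(\mathcal{F})=\max_\pi\operatorname{rank}(\boldsymbol{M}(\mathcal{F}_\pi))$, over all permutations $\pi$ of $(1,2,3,4)$. *)

theory Defs
  imports
    Jordan_Normal_Form.DL_Rank
    "HOL-Combinatorics.Permutations"
begin

text \<open>
  An order-\<open>d\<close> tensor is an entry function on multi-indices, given together with its list
  \<open>ns\<close> of \<open>d\<close> dimensions. Indices count from \<open>0\<close>, and only the entries at multi-indices in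
  \<open>indices ns\<close> belong to the tensor; all notions below ignore the other values.
\<close>

type_synonym tensor = "nat list \<Rightarrow> complex"

definition indices :: "nat list \<Rightarrow> nat list set" where
  "indices ns = {is. length is = length ns \<and> (\<forall>k<length ns. is ! k < ns ! k)}"

definition outer_product :: "complex vec list \<Rightarrow> tensor" where
  "outer_product vs is = (\<Prod>k<length vs. (vs ! k) $ (is ! k))"

definition cp_decomposition :: "nat list \<Rightarrow> tensor \<Rightarrow> nat \<Rightarrow> (nat \<Rightarrow> complex vec list) \<Rightarrow> bool" where
  "cp_decomposition ns F r a \<longleftrightarrow>
     (\<forall>i<r. length (a i) = length ns \<and> (\<forall>k<length ns. a i ! k \<in> carrier_vec (ns ! k))) \<and>
     (\<forall>is \<in> indices ns. F is = (\<Sum>i<r. outer_product (a i) is))"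

definition cp_rank :: "nat list \<Rightarrow> tensor \<Rightarrow> nat" where
  "cp_rank ns F = (LEAST r. \<exists>a. cp_decomposition ns F r a)"

text \<open>
  The pairs \<open>(i\<^sub>1, i\<^sub>2)\<close> and \<open>(i\<^sub>3, i\<^sub>4)\<close> are numbered lexicographically; the rank does not
  depend on this choice.
\<close>

definition square_unfolding :: "nat list \<Rightarrow> tensor \<Rightarrow> complex mat" where
  "square_unfolding ms G =
     mat (ms ! 0 * ms ! 1) (ms ! 2 * ms ! 3)
       (\<lambda>(r, c). G [r div ms ! 1, r mod ms ! 1, c div ms ! 3, c mod ms ! 3])"

lemma square_unfolding_entry:
  assumes "i1 < m1" "i2 < m2" "i3 < m3" "i4 < m4"
  shows "square_unfolding [m1, m2, m3, m4] G $$ (i1 * m2 + i2, i3 * m4 + i4) = G [i1, i2, i3, i4]"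
proof -
  have bound: "i * m + j < n * m" if "i < n" "j < m" for i j m n :: nat
  proof -
    have "i * m + j < Suc i * m" using that by simp
    also have "\<dots> \<le> n * m" using that by (intro mult_right_mono) auto
    finally show ?thesis .
  qed
  show ?thesis
    using assms bound[OF assms(1,2)] bound[OF assms(3,4)]
    by (simp add: square_unfolding_def eval_nat_numeral)
qed

definition mat_rank :: "complex mat \<Rightarrow> nat" where
  "mat_rank A = vec_space.rank (dim_row A) A"

text \<open>
  For a permutation \<open>\<pi>\<close> of the positions, \<open>j\<^sub>k = \<pi> k\<close>, so the dimensions of the permuted tensor
  are \<open>permute_list \<pi> ns\<close>. The multi-index \<open>(i\<^bsub>j\<^sub>1\<^esub>, \<dots>, i\<^bsub>j\<^sub>d\<^esub>)\<close> is \<open>permute_list \<pi> is\<close>, whence the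
  inverse below. It is written \<open>inv_into UNIV\<close> because \<open>HOL-Algebra\<close> shadows the prefix \<open>inv\<close>.
\<close>

definition permute_tensor :: "(nat \<Rightarrow> nat) \<Rightarrow> tensor \<Rightarrow> tensor" where
  "permute_tensor \<pi> F js = F (permute_list (inv_into UNIV \<pi>) js)"

lemma permute_tensor_permute_list:
  assumes "\<pi> permutes {..<length is}"
  shows "permute_tensor \<pi> F (permute_list \<pi> is) = F is"
proof -
  have "permute_list (inv_into UNIV \<pi>) (permute_list \<pi> is) = permute_list (\<pi> \<circ> inv_into UNIV \<pi>) is"
    using permutes_inv[OF assms] by (simp add: permute_list_compose)
  then show ?thesis
    by (simp add: permute_tensor_def permutes_inv_o(1)[OF assms])
qed

definition unfolding_rank :: "(nat \<Rightarrow> nat) \<Rightarrow> nat list \<Rightarrow> tensor \<Rightarrow> nat" where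
  "unfolding_rank \<pi> ns F = mat_rank (square_unfolding (permute_list \<pi> ns) (permute_tensor \<pi> F))"

definition rank_M_minus :: "nat list \<Rightarrow> tensor \<Rightarrow> nat" where
  "rank_M_minus ns F = Min ((\<lambda>\<pi>. unfolding_rank \<pi> ns F) ` {\<pi>. \<pi> permutes {..<4}})"

definition rank_M_plus :: "nat list \<Rightarrow> tensor \<Rightarrow> nat" where
  "rank_M_plus ns F = Max ((\<lambda>\<pi>. unfolding_rank \<pi> ns F) ` {\<pi>. \<pi> permutes {..<4}})"

end

theory Submission
  imports Defs
begin

text \<open>
  Both inequalities translate between two kinds of separation of variables. A matrix has rank at
  most \<open>r\<close> exactly when its entries have the form \<open>\<Sum>k<r. u k i * v k j\<close>.

  Lower bound: grouping the first two and the last two factors of a rank-one tensor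
  \<open>a \<otimes> b \<otimes> c \<otimes> d\<close> turns it into the rank-one matrix \<open>(a \<otimes> b) (c \<otimes> d)\<^sup>T\<close>, so a CP decomposition
  with \<open>r\<close> terms separates the square unfolding into \<open>r\<close> terms
  (\<open>mat_rank_square_unfolding_le_cp_decomposition\<close>).

  Upper bound: in a rank factorization of the unfolding, each vector \<open>u k\<close> is itself an
  \<open>m\<^sub>1 \<times> m\<^sub>2\<close> matrix and splits into \<open>min m\<^sub>1 m\<^sub>2\<close> products of a row factor and a column factor;
  likewise \<open>v k\<close> splits into \<open>min m\<^sub>3 m\<^sub>4\<close> products. Multiplying out yields
  \<open>min m\<^sub>1 m\<^sub>2 * min m\<^sub>3 m\<^sub>4\<close> rank-one tensors for each \<open>k\<close>
  (\<open>ex_cp_decomposition_square_unfolding\<close>). However the four dimensions are paired up, one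
  pair contains \<open>n\<^sub>1\<close>, and the smaller element of the other pair is at most \<open>n\<^sub>3\<close>, so this product
  is at most \<open>n\<^sub>1 n\<^sub>3\<close>.

  The sharpened form follows because the CP-rank, unlike the unfolding rank, does not change when
  the indices are permuted (\<open>cp_rank_permute_tensor\<close>): the bounds for each single permutation are
  all bounds on the same number.
\<close>

section \<open>Matrix rank as separation of variables\<close>

lemma rank_sum_of_products_le:
  fixes u v :: "nat \<Rightarrow> nat \<Rightarrow> complex"
  shows "mat_rank (mat nr nc (\<lambda>(i, j). \<Sum>k<r. u k i * v k j)) \<le> r"
proof (induction r)
  case 0
  have "mat nr nc (\<lambda>(i, j). \<Sum>k<0. u k i * v k j) = 0\<^sub>m nr nc"
    by (intro eq_matI) auto
  then show ?case
    by (simp only: mat_rank_def index_zero_mat vec_space.rank_0I)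
next
  case (Suc r)
  let ?A = "mat nr nc (\<lambda>(i, j). \<Sum>k<r. u k i * v k j)"
  let ?B = "mat nr nc (\<lambda>(i, j). u r i * v r j)"
  have "mat nr nc (\<lambda>(i, j). \<Sum>k<Suc r. u k i * v k j) = ?A + ?B"
    by (intro eq_matI) auto
  moreover have "vec_space.rank nr (?A + ?B) \<le> vec_space.rank nr ?A + vec_space.rank nr ?B"
    by (rule vec_space.rank_subadditive) auto
  moreover have "vec_space.rank nr ?B \<le> 1"
    by (rule vec_space.rank_le_1_product_entries[where f = "u r" and g = "v r" and nc = nc]) auto
  ultimately show ?case
    using Suc by (simp add: mat_rank_def)
qed

text \<open>A vector outside the span could be added to the independent set, against maximality.\<close>

lemma (in vec_space) maximal_indpt_subset_spans:
  assumes "C \<subseteq> carrier_vec n"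
    and max: "maximal S (\<lambda>T. T \<subseteq> C \<and> lin_indpt T)"
  shows "C \<subseteq> span S"
proof
  fix c assume c: "c \<in> C"
  have S: "S \<subseteq> C" "lin_indpt S"
    using max by (auto simp: maximal_def)
  then have Sn: "S \<subseteq> carrier_vec n"
    using assms(1) by blast
  show "c \<in> span S"
  proof (rule ccontr)
    assume notin: "c \<notin> span S"
    then have "c \<notin> S"
      using in_own_span[OF Sn] by blast
    moreover from this have "lin_indpt (S \<union> {c})"
      using lin_dep_iff_in_span[OF Sn S(2), of c] notin c assms(1) by auto
    ultimately show False
      using max S(1) c unfolding maximal_def by blast
  qed
qed

text \<open>
  A maximal independent set of columns has as many members as the rank, and every column is a
  combination of them; its members supply the factors \<open>u\<close> and the coefficients supply \<open>v\<close>.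
\<close>

lemma rank_factorization:
  assumes A: "A \<in> carrier_mat nr nc"
  obtains u v :: "nat \<Rightarrow> nat \<Rightarrow> complex"
  where "\<And>i j. i < nr \<Longrightarrow> j < nc \<Longrightarrow> A $$ (i, j) = (\<Sum>k<mat_rank A. u k i * v k j)"
proof -
  interpret vec_space "TYPE(complex)" nr .
  have C: "set (cols A) \<subseteq> carrier_vec nr"
    using A cols_dim by blast
  obtain S where max: "maximal S (\<lambda>T. T \<subseteq> set (cols A) \<and> lin_indpt T)"
    using maximal_exists[of "\<lambda>T. T \<subseteq> set (cols A) \<and> lin_indpt T" "card (set (cols A))" "{}"]
    by (meson List.finite_set card_mono empty_iff empty_subsetI finite_lin_indpt2 rev_finite_subset)
  then have "S \<subseteq> set (cols A)"
    by (simp add: maximal_def)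
  then have Sn: "S \<subseteq> carrier_vec nr" and fin: "finite S"
    using C finite_subset by auto
  have rank: "mat_rank A = card S"
    using rank_card_indpt[OF A max] A by (simp add: mat_rank_def)
  have "\<exists>a. col A j = lincomb a S" if "j < nc" for j
  proof -
    have "col A j \<in> span S"
      using maximal_indpt_subset_spans[OF C max] that A by (auto simp: cols_def)
    then show ?thesis
      using finite_in_span[OF fin Sn, of "col A j"] by metis
  qed
  then obtain a where a: "\<And>j. j < nc \<Longrightarrow> col A j = lincomb (a j) S"
    by metis
  obtain h where h: "bij_betw h {..<card S} S"
    using ex_bij_betw_nat_finite[OF fin] by (auto simp: atLeast0LessThan)
  show ?thesis
  proof
    fix i j assume ij: "i < nr" "j < nc"
    have "A $$ (i, j) = col A j $ i"
      using ij A by simp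
    also have "\<dots> = (\<Sum>x\<in>S. a j x * x $ i)"
      using a[OF ij(2)] lincomb_index[OF ij(1) Sn] by simp
    also have "\<dots> = (\<Sum>k<card S. a j (h k) * h k $ i)"
      using sum.reindex_bij_betw[OF h, of "\<lambda>x. a j x * x $ i"] by simp
    finally show "A $$ (i, j) = (\<Sum>k<mat_rank A. h k $ i * a j (h k))"
      by (simp add: rank mult.commute)
  qed
qed

text \<open>
  An \<open>m \<times> n\<close> array is the sum of its rows times unit vectors, and also of its columns times
  unit vectors; the cheaper of the two has \<open>min m n\<close> terms.
\<close>

lemma split_into_min_products:
  fixes w :: "nat \<Rightarrow> nat \<Rightarrow> 'a::comm_semiring_1"
  obtains f g where "\<And>i j. i < m \<Longrightarrow> j < n \<Longrightarrow> w i j = (\<Sum>k<min m n. f k i * g k j)"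
proof (cases "m \<le> n")
  case True
  show ?thesis
  proof
    fix i j assume "i < m" "j < n"
    then show "w i j = (\<Sum>k<min m n. of_bool (i = k) * w k j)"
      using True by (simp add: of_bool_def if_distrib[of "\<lambda>x. x * _"] sum.delta cong: if_cong)
  qed
next
  case False
  show ?thesis
  proof
    fix i j assume "i < m" "j < n"
    then show "w i j = (\<Sum>k<min m n. w i k * of_bool (j = k))"
      using False by (simp add: of_bool_def if_distrib[of "\<lambda>x. _ * x"] sum.delta cong: if_cong)
  qed
qed

section \<open>CP decompositions and the square unfolding\<close>

lemma mat_rank_square_unfolding_le_cp_decomposition:
  assumes "cp_decomposition [m1, m2, m3, m4] G r a"
  shows "mat_rank (square_unfolding [m1, m2, m3, m4] G) \<le> r"
proof -
  let ?u = "\<lambda>k i. (a k ! 0) $ (i div m2) * (a k ! 1) $ (i mod m2)"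
  let ?v = "\<lambda>k j. (a k ! 2) $ (j div m4) * (a k ! 3) $ (j mod m4)"
  have "square_unfolding [m1, m2, m3, m4] G
      = mat (m1 * m2) (m3 * m4) (\<lambda>(i, j). \<Sum>k<r. ?u k i * ?v k j)"
  proof (rule eq_matI, goal_cases)
    case (1 i j)
    then have ij: "i < m1 * m2" "j < m3 * m4"
      by auto
    then have pos: "0 < m2" "0 < m4"
      by (auto intro: Nat.gr0I)
    let ?is = "[i div m2, i mod m2, j div m4, j mod m4]"
    have "?is \<in> indices [m1, m2, m3, m4]"
      using ij pos
      by (auto simp: indices_def less_Suc_eq numeral_nat less_mult_imp_div_less nth_Cons')
    then have "G ?is = (\<Sum>k<r. outer_product (a k) ?is)"
      using assms by (auto simp: cp_decomposition_def)
    also have "\<dots> = (\<Sum>k<r. ?u k i * ?v k j)"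
    proof (rule sum.cong)
      fix k assume "k \<in> {..<r}"
      then have "length (a k) = 4"
        using assms by (auto simp: cp_decomposition_def)
      then show "outer_product (a k) ?is = ?u k i * ?v k j"
        by (simp add: outer_product_def eval_nat_numeral mult.assoc)
    qed simp
    finally show ?case
      using ij by (simp add: square_unfolding_def eval_nat_numeral)
  qed (auto simp: square_unfolding_def eval_nat_numeral)
  then show ?thesis
    using rank_sum_of_products_le[where u = ?u and v = ?v and nr = "m1 * m2" and nc = "m3 * m4" and r = r] by simp
qed

lemma cp_decomposition_over_finite_set:
  assumes "finite S"
    and "\<And>s. s \<in> S \<Longrightarrow> length (b s) = length ns"
    and "\<And>s k. s \<in> S \<Longrightarrow> k < length ns \<Longrightarrow> b s ! k \<in> carrier_vec (ns ! k)"
    and "\<And>is. is \<in> indices ns \<Longrightarrow> F is = (\<Sum>s\<in>S. outer_product (b s) is)"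
  shows "\<exists>a. cp_decomposition ns F (card S) a"
proof -
  obtain h where h: "bij_betw h {..<card S} S"
    using ex_bij_betw_nat_finite[OF assms(1)] by (auto simp: atLeast0LessThan)
  have "F is = (\<Sum>i<card S. outer_product (b (h i)) is)" if "is \<in> indices ns" for "is"
    using assms(4)[OF that] sum.reindex_bij_betw[OF h, of "\<lambda>s. outer_product (b s) is"] by simp
  then have "cp_decomposition ns F (card S) (b \<circ> h)"
    using assms(2,3) bij_betwE[OF h] by (auto simp: cp_decomposition_def)
  then show ?thesis
    by blast
qed

lemma ex_cp_decomposition_square_unfolding:
  "\<exists>a. cp_decomposition [m1, m2, m3, m4] G
     (min m1 m2 * min m3 m4 * mat_rank (square_unfolding [m1, m2, m3, m4] G)) a"
proof -
  let ?M = "square_unfolding [m1, m2, m3, m4] G"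
  let ?p = "min m1 m2" and ?q = "min m3 m4" and ?r = "mat_rank ?M"
  have "?M \<in> carrier_mat (m1 * m2) (m3 * m4)"
    by (simp add: square_unfolding_def eval_nat_numeral)
  from rank_factorization[OF this] obtain u v where
    uv: "\<And>i j. i < m1 * m2 \<Longrightarrow> j < m3 * m4 \<Longrightarrow> ?M $$ (i, j) = (\<Sum>t<?r. u t i * v t j)"
    by metis
  have "\<exists>f g. \<forall>i<m1. \<forall>j<m2. u t (i * m2 + j) = (\<Sum>k<?p. f k i * g k j)" for t
    using split_into_min_products[of m1 m2 "\<lambda>i j. u t (i * m2 + j)"] by metis
  then obtain f1 f2 where
    f: "\<And>t i j. i < m1 \<Longrightarrow> j < m2 \<Longrightarrow> u t (i * m2 + j) = (\<Sum>k<?p. f1 t k i * f2 t k j)"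
    by metis
  have "\<exists>f g. \<forall>i<m3. \<forall>j<m4. v t (i * m4 + j) = (\<Sum>k<?q. f k i * g k j)" for t
    using split_into_min_products[of m3 m4 "\<lambda>i j. v t (i * m4 + j)"] by metis
  then obtain f3 f4 where
    g: "\<And>t i j. i < m3 \<Longrightarrow> j < m4 \<Longrightarrow> v t (i * m4 + j) = (\<Sum>k<?q. f3 t k i * f4 t k j)"
    by metis
  define S where "S = {..<?r} \<times> {..<?p} \<times> {..<?q}"
  define b where "b = (\<lambda>(t, k, l). [vec m1 (f1 t k), vec m2 (f2 t k), vec m3 (f3 t l), vec m4 (f4 t l)])"
  have "\<exists>a. cp_decomposition [m1, m2, m3, m4] G (card S) a"
  proof (rule cp_decomposition_over_finite_set[where b = b])
    fix "is" assume "is \<in> indices [m1, m2, m3, m4]"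
    then have len: "length is = 4" and bnd: "\<And>k. k < 4 \<Longrightarrow> is ! k < [m1, m2, m3, m4] ! k"
      by (auto simp: indices_def)
    define i1 i2 i3 i4 where i_defs: "i1 = is ! 0" "i2 = is ! 1" "i3 = is ! 2" "i4 = is ! 3"
    have "is": "is = [i1, i2, i3, i4]"
      using len by (intro nth_equalityI) (auto simp: i_defs less_Suc_eq numeral_nat)
    have i: "i1 < m1" "i2 < m2" "i3 < m3" "i4 < m4"
      using bnd[of 0] bnd[of 1] bnd[of 2] bnd[of 3] by (auto simp: i_defs eval_nat_numeral)
    have bound: "k * m + l < n * m" if "k < n" "l < m" for k l m n :: nat
    proof -
      have "k * m + l < Suc k * m" using that by simp
      also have "\<dots> \<le> n * m" using that by (intro mult_right_mono) auto
      finally show ?thesis .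
    qed
    have "G is = ?M $$ (i1 * m2 + i2, i3 * m4 + i4)"
      using square_unfolding_entry[OF i] "is" by simp
    also have "\<dots> = (\<Sum>t<?r. u t (i1 * m2 + i2) * v t (i3 * m4 + i4))"
      using bound i by (intro uv) auto
    also have "\<dots> = (\<Sum>t<?r. \<Sum>k<?p. \<Sum>l<?q. f1 t k i1 * f2 t k i2 * (f3 t l i3 * f4 t l i4))"
      by (simp only: f[OF i(1,2)] g[OF i(3,4)] sum_product)
    also have "\<dots> = (\<Sum>(t, k, l)\<in>S. f1 t k i1 * f2 t k i2 * (f3 t l i3 * f4 t l i4))"
      unfolding S_def by (simp only: sum.cartesian_product case_prod_beta fst_conv snd_conv)
    also have "\<dots> = (\<Sum>s\<in>S. outer_product (b s) is)"
      using i by (intro sum.cong) (auto simp: b_def outer_product_def "is" eval_nat_numeral)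
    finally show "G is = (\<Sum>s\<in>S. outer_product (b s) is)" .
  qed (auto simp: S_def b_def less_Suc_eq numeral_nat)
  moreover have "card S = ?p * ?q * ?r"
    by (simp add: S_def)
  ultimately show ?thesis
    by simp
qed

section \<open>Invariance of the CP-rank under permutations\<close>

lemma outer_product_permute_list:
  assumes "\<pi> permutes {..<length vs}" "length is = length vs"
  shows "outer_product (permute_list \<pi> vs) (permute_list \<pi> is) = outer_product vs is"
proof -
  have "outer_product (permute_list \<pi> vs) (permute_list \<pi> is)
      = (\<Prod>k<length vs. (vs ! \<pi> k) $ (is ! \<pi> k))"
    using assms by (simp add: outer_product_def permute_list_nth)
  also have "\<dots> = outer_product vs is"
    using prod.permute[OF assms(1), of "\<lambda>k. (vs ! k) $ (is ! k)"]
    by (simp add: outer_product_def o_def)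
  finally show ?thesis .
qed

lemma permute_list_inverses:
  assumes "\<pi> permutes {..<length xs}"
  shows "permute_list \<pi> (permute_list (inv_into UNIV \<pi>) xs) = xs"
    and "permute_list (inv_into UNIV \<pi>) (permute_list \<pi> xs) = xs"
proof -
  have "permute_list \<pi> (permute_list (inv_into UNIV \<pi>) xs) = permute_list (inv_into UNIV \<pi> \<circ> \<pi>) xs"
    using assms by (simp add: permute_list_compose)
  then show "permute_list \<pi> (permute_list (inv_into UNIV \<pi>) xs) = xs"
    by (simp add: permutes_inv_o(2)[OF assms])
  have "permute_list (inv_into UNIV \<pi>) (permute_list \<pi> xs) = permute_list (\<pi> \<circ> inv_into UNIV \<pi>) xs"
    using permutes_inv[OF assms] by (simp add: permute_list_compose)
  then show "permute_list (inv_into UNIV \<pi>) (permute_list \<pi> xs) = xs"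
    by (simp add: permutes_inv_o(1)[OF assms])
qed

lemma permute_list_in_indices:
  assumes "\<pi> permutes {..<length ns}" "is \<in> indices ns"
  shows "permute_list \<pi> is \<in> indices (permute_list \<pi> ns)"
  using assms permutes_in_image[OF assms(1)] by (auto simp: indices_def permute_list_nth)

lemma cp_decomposition_permute:
  assumes \<pi>: "\<pi> permutes {..<length ns}" and a: "cp_decomposition ns F r a"
  shows "cp_decomposition (permute_list \<pi> ns) (permute_tensor \<pi> F) r (permute_list \<pi> \<circ> a)"
  unfolding cp_decomposition_def
proof (intro conjI ballI allI impI)
  fix i assume "i < r"
  then have len: "length (a i) = length ns"
    and car: "\<And>k. k < length ns \<Longrightarrow> a i ! k \<in> carrier_vec (ns ! k)"
    using a by (auto simp: cp_decomposition_def)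
  then show "length ((permute_list \<pi> \<circ> a) i) = length (permute_list \<pi> ns)"
    by simp
  fix k assume k: "k < length (permute_list \<pi> ns)"
  then have "\<pi> k < length ns"
    using permutes_in_image[OF \<pi>, of k] by simp
  then show "(permute_list \<pi> \<circ> a) i ! k \<in> carrier_vec (permute_list \<pi> ns ! k)"
    using k \<pi> len car by (simp add: permute_list_nth)
next
  fix js assume js: "js \<in> indices (permute_list \<pi> ns)"
  define ix where "ix = permute_list (inv_into UNIV \<pi>) js"
  have len: "length js = length ns"
    using js by (simp add: indices_def)
  have js_eq: "js = permute_list \<pi> ix"
    using permute_list_inverses(1)[of \<pi> js] \<pi> len by (simp add: ix_def)
  have "ix \<in> indices ns"
    using permute_list_in_indices[of "inv_into UNIV \<pi>" "permute_list \<pi> ns" js]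
      permutes_inv[OF \<pi>] js permute_list_inverses(2)[OF \<pi>] by (simp add: ix_def)
  then have "F ix = (\<Sum>i<r. outer_product (a i) ix)"
    using a by (simp add: cp_decomposition_def)
  also have "\<dots> = (\<Sum>i<r. outer_product (permute_list \<pi> (a i)) js)"
  proof (rule sum.cong)
    fix i assume "i \<in> {..<r}"
    then have "length (a i) = length ns"
      using a by (simp add: cp_decomposition_def)
    then show "outer_product (a i) ix = outer_product (permute_list \<pi> (a i)) js"
      unfolding js_eq using \<pi> len by (simp add: outer_product_permute_list ix_def)
  qed simp
  finally show "permute_tensor \<pi> F js = (\<Sum>i<r. outer_product ((permute_list \<pi> \<circ> a) i) js)"
    by (simp add: permute_tensor_def ix_def)
qed

text \<open>
  Permuting back restores the tensor only on the multi-indices in \<open>indices ns\<close> (elsewhere the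
  lists may have the wrong length), which is all that a CP decomposition refers to.
\<close>

lemma cp_rank_permute_tensor:
  assumes \<pi>: "\<pi> permutes {..<length ns}"
  shows "cp_rank (permute_list \<pi> ns) (permute_tensor \<pi> F) = cp_rank ns F"
proof -
  have "(\<exists>a. cp_decomposition (permute_list \<pi> ns) (permute_tensor \<pi> F) r a)
      \<longleftrightarrow> (\<exists>a. cp_decomposition ns F r a)" for r
  proof
    assume "\<exists>a. cp_decomposition ns F r a"
    then show "\<exists>a. cp_decomposition (permute_list \<pi> ns) (permute_tensor \<pi> F) r a"
      using cp_decomposition_permute[OF \<pi>] by blast
  next
    let ?\<sigma> = "inv_into UNIV \<pi>"
    assume "\<exists>a. cp_decomposition (permute_list \<pi> ns) (permute_tensor \<pi> F) r a"
    then obtain a where "cp_decomposition (permute_list ?\<sigma> (permute_list \<pi> ns))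
        (permute_tensor ?\<sigma> (permute_tensor \<pi> F)) r a"
      using cp_decomposition_permute[of ?\<sigma> "permute_list \<pi> ns"] permutes_inv[OF \<pi>] by fastforce
    moreover have "permute_tensor ?\<sigma> (permute_tensor \<pi> F) is = F is" if "is \<in> indices ns" for "is"
    proof -
      have "\<pi> permutes {..<length is}"
        using that \<pi> by (simp add: indices_def)
      then show ?thesis
        by (simp add: permute_tensor_def[of ?\<sigma>] permutes_inv_inv permute_tensor_permute_list)
    qed
    ultimately have "cp_decomposition ns F r a"
      by (simp add: cp_decomposition_def permute_list_inverses(2)[OF \<pi>])
    then show "\<exists>a. cp_decomposition ns F r a"
      by blast
  qed
  then show ?thesis
    by (simp add: cp_rank_def)
qed

section \<open>Rank bounds\<close>

text \<open>
  The least number of terms is attained only because some decomposition exists at all; the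
  construction behind the upper bound provides one.
\<close>

lemma mat_rank_square_unfolding_le_cp_rank:
  "mat_rank (square_unfolding [m1, m2, m3, m4] G) \<le> cp_rank [m1, m2, m3, m4] G"
proof -
  have "\<exists>a. cp_decomposition [m1, m2, m3, m4] G (cp_rank [m1, m2, m3, m4] G) a"
    unfolding cp_rank_def by (rule LeastI_ex) (use ex_cp_decomposition_square_unfolding in blast)
  then show ?thesis
    using mat_rank_square_unfolding_le_cp_decomposition by blast
qed

lemma cp_rank_le_mat_rank_square_unfolding:
  "cp_rank [m1, m2, m3, m4] G
     \<le> min m1 m2 * min m3 m4 * mat_rank (square_unfolding [m1, m2, m3, m4] G)"
  unfolding cp_rank_def by (rule Least_le) (rule ex_cp_decomposition_square_unfolding)

text \<open>
  Of two distinct positions one is at most \<open>2\<close>, so each of the two minima is at most \<open>xs ! 2\<close>;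
  the pair that contains position \<open>0\<close> has minimum at most \<open>xs ! 0\<close>.
\<close>

lemma min_pairs_permuted_le:
  fixes xs :: "nat list"
  assumes "sorted xs" "length xs = 4" and \<pi>: "\<pi> permutes {..<4}"
  shows "min (xs ! \<pi> 0) (xs ! \<pi> 1) * min (xs ! \<pi> 2) (xs ! \<pi> 3) \<le> xs ! 0 * xs ! 2"
proof -
  have two: "min (xs ! a) (xs ! b) \<le> xs ! 2" if "a < 4" "b < 4" "a \<noteq> b" for a b
  proof -
    have "a \<le> 2 \<or> b \<le> 2"
      using that by linarith
    then show ?thesis
      using assms(1,2) sorted_nth_mono[of xs _ 2] by (auto simp: min_le_iff_disj)
  qed
  have inj: "\<pi> i = \<pi> j \<longleftrightarrow> i = j" for i j
    using permutes_inj[OF \<pi>] by (auto dest: injD)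
  have lt: "\<pi> i < 4" if "i < 4" for i
    using permutes_in_image[OF \<pi>, of i] that by simp
  have "0 \<in> \<pi> ` {..<4}"
    using permutes_image[OF \<pi>] by simp
  then have "(\<pi> 0 = 0 \<or> \<pi> 1 = 0) \<or> (\<pi> 2 = 0 \<or> \<pi> 3 = 0)"
    by (auto simp: less_Suc_eq numeral_nat)
  then show ?thesis
  proof
    assume "\<pi> 0 = 0 \<or> \<pi> 1 = 0"
    then have "min (xs ! \<pi> 0) (xs ! \<pi> 1) \<le> xs ! 0"
      by auto
    then show ?thesis
      using two[of "\<pi> 2" "\<pi> 3"] inj lt by (intro mult_mono) auto
  next
    assume "\<pi> 2 = 0 \<or> \<pi> 3 = 0"
    then have "min (xs ! \<pi> 2) (xs ! \<pi> 3) \<le> xs ! 0"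
      by auto
    moreover have "min (xs ! \<pi> 0) (xs ! \<pi> 1) \<le> xs ! 2"
      using two[of "\<pi> 0" "\<pi> 1"] inj lt by auto
    ultimately show ?thesis
      by (subst mult.commute) (intro mult_mono, auto)
  qed
qed

theorem mainTheorem2:
  fixes n1 n2 n3 n4 :: nat and F :: tensor
  assumes "n1 \<le> n2" and "n2 \<le> n3" and "n3 \<le> n4"
  shows "(\<forall>\<pi>. \<pi> permutes {..<4} \<longrightarrow>
            mat_rank (square_unfolding (permute_list \<pi> [n1, n2, n3, n4]) (permute_tensor \<pi> F))
              \<le> cp_rank (permute_list \<pi> [n1, n2, n3, n4]) (permute_tensor \<pi> F) \<and>
            cp_rank (permute_list \<pi> [n1, n2, n3, n4]) (permute_tensor \<pi> F)
              \<le> n1 * n3 * mat_rank (square_unfolding (permute_list \<pi> [n1, n2, n3, n4]) (permute_tensor \<pi> F)))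
       \<and> rank_M_plus [n1, n2, n3, n4] F \<le> cp_rank [n1, n2, n3, n4] F
       \<and> cp_rank [n1, n2, n3, n4] F \<le> n1 * n3 * rank_M_minus [n1, n2, n3, n4] F"
proof -
  let ?ns = "[n1, n2, n3, n4]"
  have single: "unfolding_rank \<pi> ?ns F \<le> cp_rank (permute_list \<pi> ?ns) (permute_tensor \<pi> F) \<and>
      cp_rank (permute_list \<pi> ?ns) (permute_tensor \<pi> F) \<le> n1 * n3 * unfolding_rank \<pi> ?ns F"
    if \<pi>: "\<pi> permutes {..<4}" for \<pi>
  proof -
    let ?m = "\<lambda>k. ?ns ! \<pi> k"
    have pl: "permute_list \<pi> ?ns = [?m 0, ?m 1, ?m 2, ?m 3]"
      by (simp add: permute_list_def eval_nat_numeral)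
    have "sorted ?ns"
      using assms by simp
    then have "min (?m 0) (?m 1) * min (?m 2) (?m 3) \<le> n1 * n3"
      using min_pairs_permuted_le[of ?ns \<pi>] \<pi> by simp
    then have "min (?m 0) (?m 1) * min (?m 2) (?m 3) * unfolding_rank \<pi> ?ns F
        \<le> n1 * n3 * unfolding_rank \<pi> ?ns F"
      by (rule mult_right_mono) simp
    then show ?thesis
      using mat_rank_square_unfolding_le_cp_rank cp_rank_le_mat_rank_square_unfolding
      unfolding unfolding_rank_def pl by (blast intro: order_trans)
  qed
  have inv: "cp_rank (permute_list \<pi> ?ns) (permute_tensor \<pi> F) = cp_rank ?ns F"
    if "\<pi> permutes {..<4}" for \<pi>
    using cp_rank_permute_tensor[of \<pi> ?ns F] that by (simp add: numeral_nat)
  let ?R = "(\<lambda>\<pi>. unfolding_rank \<pi> ?ns F) ` {\<pi>. \<pi> permutes {..<4}}"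
  have R: "finite ?R" "?R \<noteq> {}"
    using finite_permutations[of "{..<4::nat}"] by (auto intro: permutes_id)
  have bounds: "x \<le> cp_rank ?ns F \<and> cp_rank ?ns F \<le> n1 * n3 * x" if "x \<in> ?R" for x
    using that single inv by auto
  have "rank_M_plus ?ns F \<le> cp_rank ?ns F"
    unfolding rank_M_plus_def using bounds[OF Max_in[OF R]] by blast
  moreover have "cp_rank ?ns F \<le> n1 * n3 * rank_M_minus ?ns F"
    unfolding rank_M_minus_def using bounds[OF Min_in[OF R]] by blast
  ultimately show ?thesis
    using single by (auto simp: unfolding_rank_def)
qed

end
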